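(* Let $X\subset\mathbb{R}^p$, let $Y\subset\mathbb{R}^q$ be closed, let $\theta_l,\theta_f:\mathbb{R}^p\times\mathbb{R}^q\to\mathbb{R}$ be functions, and let $K:X\rightrightarrows Y$ be a set-valued map. Consider the optimistic bilevel programming problem $$\min_{x,y}\ \theta_l(x,y)\quad\text{s.t.}\quad x\in X,\ y\in S(x),$$ where $S(x):=\operatorname{argmin}_y\{\theta_f(x,y) : y\in K(x)\}$. Assume that (i) $\theta_l$ is lower semicontinuous; (ii) $\theta_f$ is continuous; (iii) $X$ is nonempty and compact; (iv) $K:X\rightrightarrows Y$ is both upper and lower semicontinuous, and has nonempty compact (closed) values. Then the problem admits a solution, i.e. there exists $(x^*,y^* )$ with $x^*\in X$, $y^*\in S(x^* )$ and $\theta_l(x^*,y^* )\leq\theta_l(x,y)$ for all $x\in X$, $y\in S(x)$.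
   Context: A set-valued map $M:X\rightrightarrows Y$ assigns to each $x\in X$ a subset $M(x)\subset Y$. For metric spaces $X,Y$: $M$ is upper semicontinuous at $x_0$ if for every open $V\subset Y$ with $M(x_0)\subset V$ there is a neighborhood $U$ of $x_0$ in $X$ with $M(x)\subset V$ for all $x\in U$; $M$ is lower semicontinuous at $x_0$ if for every open $V\subset Y$ with $M(x_0)\cap V\neq\emptyset$ there is a neighborhood $U$ of $x_0$ in $X$ with $M(x)\cap V\neq\emptyset$ for all $x\in U$. $M$ is upper (lower) semicontinuous if it is so at every point of $X$. The sets $X$ and $Y$ carry the Euclidean metric. For real-valued functions, lower semicontinuity has its usual meaning. *)

theory Defs
  imports "HOL-Analysis.Analysis"
begin

(* A set-valued map from X to Y is a function K together with the carriers X and Y, where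
   K x is a subset of Y for every x in X; the values of K outside X are irrelevant.
   Open sets and neighbourhoods are taken relative to the subspaces X and Y. *)

definition set_valued_map_on ::
  "'a set \<Rightarrow> 'b set \<Rightarrow> ('a \<Rightarrow> 'b set) \<Rightarrow> bool" where
  "set_valued_map_on X Y K \<longleftrightarrow> (\<forall>x\<in>X. K x \<subseteq> Y)"

definition usc_map_at ::
  "'a::metric_space set \<Rightarrow> 'b::metric_space set \<Rightarrow> ('a \<Rightarrow> 'b set) \<Rightarrow> 'a \<Rightarrow> bool" where
  "usc_map_at X Y K x0 \<longleftrightarrow>
     (\<forall>V. openin (top_of_set Y) V \<and> K x0 \<subseteq> V \<longrightarrow>
        (\<exists>U. openin (top_of_set X) U \<and> x0 \<in> U \<and> (\<forall>x\<in>U. K x \<subseteq> V)))"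

definition lsc_map_at ::
  "'a::metric_space set \<Rightarrow> 'b::metric_space set \<Rightarrow> ('a \<Rightarrow> 'b set) \<Rightarrow> 'a \<Rightarrow> bool" where
  "lsc_map_at X Y K x0 \<longleftrightarrow>
     (\<forall>V. openin (top_of_set Y) V \<and> K x0 \<inter> V \<noteq> {} \<longrightarrow>
        (\<exists>U. openin (top_of_set X) U \<and> x0 \<in> U \<and> (\<forall>x\<in>U. K x \<inter> V \<noteq> {})))"

definition usc_map_on ::
  "'a::metric_space set \<Rightarrow> 'b::metric_space set \<Rightarrow> ('a \<Rightarrow> 'b set) \<Rightarrow> bool" where
  "usc_map_on X Y K \<longleftrightarrow> (\<forall>x0\<in>X. usc_map_at X Y K x0)"

definition lsc_map_on ::
  "'a::metric_space set \<Rightarrow> 'b::metric_space set \<Rightarrow> ('a \<Rightarrow> 'b set) \<Rightarrow> bool" where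
  "lsc_map_on X Y K \<longleftrightarrow> (\<forall>x0\<in>X. lsc_map_at X Y K x0)"

definition lower_semicontinuous :: "('a::topological_space \<Rightarrow> real) \<Rightarrow> bool" where
  "lower_semicontinuous f \<longleftrightarrow>
     (\<forall>x0. \<forall>c. c < f x0 \<longrightarrow> eventually (\<lambda>x. c < f x) (nhds x0))"

(* The set of all minimizers; the library constant arg_min only selects one of them. *)
definition argmin_set :: "('b \<Rightarrow> real) \<Rightarrow> 'b set \<Rightarrow> 'b set" where
  "argmin_set f A = {y. is_arg_min f (\<lambda>y. y \<in> A) y}"

definition lower_level_solutions ::
  "('a \<times> 'b \<Rightarrow> real) \<Rightarrow> ('a \<Rightarrow> 'b set) \<Rightarrow> 'a \<Rightarrow> 'b set" where
  "lower_level_solutions \<theta>f K x = argmin_set (\<lambda>y. \<theta>f (x, y)) (K x)"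

end

theory Submission
  imports Defs
begin

text \<open>Upper semicontinuity with compact values makes the graph of \<open>K\<close> over \<open>X\<close> compact; lower
  semicontinuity of \<open>K\<close> and continuity of \<open>\<theta>f\<close> make the graph of the solution map relatively closed
  in it. The leader thus minimizes a lower semicontinuous function over a nonempty compact set.\<close>

text \<open>Lower semicontinuity makes the sets \<open>{x. f b < f x}\<close> open, and without a
  minimizer those with \<open>b\<close> in \<open>C\<close> cover \<open>C\<close>. In a finite
  subcover, an index \<open>m\<close> with least value \<open>f m\<close> is covered by no member, a
  contradiction.\<close>

lemma lower_semicontinuous_attains_inf:
  assumes f: "lower_semicontinuous f" and C: "compact C" "C \<noteq> {}"
  shows "\<exists>x\<in>C. \<forall>y\<in>C. f x \<le> f y"
proof (rule ccontr)
  assume no_min: "\<not> ?thesis"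
  have "open {x. c < f x}" for c
    unfolding open_subopen[of "{x. c < f x}"]
    using f by (fastforce simp: lower_semicontinuous_def eventually_nhds)
  moreover have "C \<subseteq> (\<Union>b\<in>C. {x. f b < f x})"
    using no_min by (auto simp: not_le)
  ultimately obtain D where D: "D \<subseteq> C" "finite D" "C \<subseteq> (\<Union>b\<in>D. {x. f b < f x})"
    using compactE_image[OF C(1), of C "\<lambda>b. {x. f b < f x}"] by metis
  then have "D \<noteq> {}"
    using C(2) by auto
  then obtain m where "m \<in> D" "\<forall>b\<in>D. f m \<le> f b"
    using D(2) by (metis arg_min_if_finite(1) arg_min_least)
  then show False
    using D by force
qed

text \<open>Sequential compactness: first components converge to some \<open>x\<close> along a
  subsequence, upper semicontinuity drives the second components towards the set \<open>K x\<close>,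
  and compactness of \<open>K x\<close> turns this into convergence to a point after a further
  extraction.\<close>

lemma usc_map_on_compact_graph:
  fixes K :: "'a::metric_space \<Rightarrow> 'b::metric_space set"
  assumes K: "set_valued_map_on X Y K" "usc_map_on X Y K"
    and X: "compact X" and vals: "\<And>x. x \<in> X \<Longrightarrow> K x \<noteq> {} \<and> compact (K x)"
  shows "compact (Sigma X K)"
  unfolding compact_def
proof (intro allI impI)
  fix s :: "nat \<Rightarrow> 'a \<times> 'b"
  assume s: "\<forall>n. s n \<in> Sigma X K"
  then have fst_s: "fst (s n) \<in> X" and snd_s: "snd (s n) \<in> K (fst (s n))" for n
    by (metis mem_Sigma_iff prod.collapse)+
  obtain x r where x: "x \<in> X" and r: "strict_mono r" "(\<lambda>n. fst (s (r n))) \<longlonglongrightarrow> x"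
    using seq_compactE[OF X[unfolded compact_eq_seq_compact_metric], of "\<lambda>n. fst (s n)"] fst_s
    by (auto simp: o_def)
  have near: "eventually (\<lambda>n. infdist (snd (s (r n))) (K x) < e) sequentially" if "e > 0" for e
  proof -
    \<comment> \<open>The \<open>e\<close>-neighbourhood of \<open>K x\<close> within
      \<open>Y\<close> is the open set on which upper semicontinuity is tested.\<close>
    let ?V = "Y \<inter> {y. infdist y (K x) < e}"
    have "openin (top_of_set Y) ?V"
      by (intro openin_open_Int open_Collect_less continuous_intros)
    moreover have "K x \<subseteq> ?V"
      using K(1) x that by (auto simp: set_valued_map_on_def)
    ultimately obtain U where U: "openin (top_of_set X) U" "x \<in> U" "\<And>x'. x' \<in> U \<Longrightarrow> K x' \<subseteq> ?V"
      using K(2) x unfolding usc_map_on_def usc_map_at_def by meson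
    obtain T where "open T" "U = X \<inter> T"
      using U(1) by (auto simp: openin_open)
    then have "eventually (\<lambda>n. fst (s (r n)) \<in> U) sequentially"
      using topological_tendstoD[OF r(2)] U(2) fst_s by auto
    then show ?thesis
      by eventually_elim (use U(3) snd_s in blast)
  qed
  have dist0: "(\<lambda>n. infdist (snd (s (r n))) (K x)) \<longlonglongrightarrow> 0"
  proof (rule order_tendstoI)
    show "eventually (\<lambda>n. a < infdist (snd (s (r n))) (K x)) sequentially" if "a < 0" for a
      using that by (intro always_eventually allI less_le_trans[OF _ infdist_nonneg])
  qed (rule near)
  \<comment> \<open>Compactness of \<open>K x\<close> provides nearest points. They replace the
    second components by a sequence \<open>z\<close> inside \<open>K x\<close>, from which a
    convergent subsequence can be extracted.\<close>
  have "\<exists>z\<in>K x. infdist y (K x) = dist y z" for y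
  proof -
    obtain z where z: "z \<in> K x" "\<forall>z'\<in>K x. dist y z \<le> dist y z'"
      using continuous_attains_inf[of "K x" "dist y"] vals[OF x]
        continuous_on_dist[OF continuous_on_const continuous_on_id] by blast
    then have "dist y z \<le> infdist y (K x)"
      using vals[OF x] by (auto simp: infdist_notempty intro: cINF_greatest)
    then show ?thesis
      using z(1) infdist_le[OF z(1), of y] by (metis antisym)
  qed
  then have "\<forall>n. \<exists>z. z \<in> K x \<and> infdist (snd (s (r n))) (K x) = dist (snd (s (r n))) z"
    by blast
  from choice[OF this] obtain z
    where z: "\<And>n. z n \<in> K x" "\<And>n. infdist (snd (s (r n))) (K x) = dist (snd (s (r n))) (z n)"
    by blast
  obtain w r' where w: "w \<in> K x" and r': "strict_mono r'" "(z \<circ> r') \<longlonglongrightarrow> w"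
    using seq_compactE[of "K x" z] vals[OF x] z(1) by (auto simp: compact_eq_seq_compact_metric)
  have "(\<lambda>n. dist (snd (s (r (r' n)))) (z (r' n))) \<longlonglongrightarrow> 0"
    using LIMSEQ_subseq_LIMSEQ[OF dist0 r'(1)] by (simp add: z(2) o_def)
  \<comment> \<open>By the triangle inequality through \<open>z (r' n)\<close>, this sum bounds the
    distance from the second component to \<open>w\<close>.\<close>
  then have "(\<lambda>n. dist (snd (s (r (r' n)))) (z (r' n)) + dist (z (r' n)) w) \<longlonglongrightarrow> 0 + 0"
    using r'(2)[unfolded tendsto_dist_iff[of _ w]] by (intro tendsto_add) (simp_all add: o_def)
  then have lim0: "(\<lambda>n. dist (snd (s (r (r' n)))) (z (r' n)) + dist (z (r' n)) w) \<longlonglongrightarrow> 0"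
    by simp
  have "(\<lambda>n. dist (snd (s (r (r' n)))) w) \<longlonglongrightarrow> 0"
    by (rule tendsto_sandwich[OF _ _ tendsto_const lim0]) (simp_all add: dist_triangle)
  then have "(\<lambda>n. snd (s (r (r' n)))) \<longlonglongrightarrow> w"
    by (rule tendsto_dist_iff[THEN iffD2])
  moreover have "(\<lambda>n. fst (s (r (r' n)))) \<longlonglongrightarrow> x"
    using LIMSEQ_subseq_LIMSEQ[OF r(2) r'(1)] by (simp add: o_def)
  ultimately have "(\<lambda>n. (fst (s (r (r' n))), snd (s (r (r' n))))) \<longlonglongrightarrow> (x, w)"
    by (rule tendsto_Pair[rotated])
  then have "(s \<circ> (r \<circ> r')) \<longlonglongrightarrow> (x, w)"
    by (simp add: o_def)
  then show "\<exists>l\<in>Sigma X K. \<exists>r. strict_mono r \<and> (s \<circ> r) \<longlonglongrightarrow> l"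
    using x w strict_mono_o[OF r(1) r'(1)] by blast
qed

lemma lower_level_solutions_iff:
  "y \<in> lower_level_solutions f K x \<longleftrightarrow> y \<in> K x \<and> (\<forall>z\<in>K x. f (x, y) \<le> f (x, z))"
  by (auto simp: lower_level_solutions_def argmin_set_def is_arg_min_def not_less)

text \<open>It suffices that the solution graph is closed, since it lies in the compact graph of
  \<open>K\<close>. Were the limit \<open>y\<close> beaten by some \<open>z\<close> in
  \<open>K x\<close>, lower semicontinuity would supply points near \<open>z\<close> that are
  feasible for nearby parameters and beat the minimizers there.\<close>

lemma compact_graph_lower_level_solutions:
  fixes K :: "'a::metric_space \<Rightarrow> 'b::metric_space set"
  assumes K: "set_valued_map_on X Y K" "lsc_map_on X Y K" "compact (Sigma X K)"
    and f: "continuous_on UNIV f"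
  shows "compact (Sigma X (lower_level_solutions f K))" (is "compact ?G")
proof -
  have "closed ?G"
    unfolding closed_sequential_limits
  proof (intro allI impI, elim conjE)
    fix s :: "nat \<Rightarrow> 'a \<times> 'b" and l
    assume s: "\<forall>n. s n \<in> ?G" "s \<longlonglongrightarrow> l"
    obtain x y where l: "l = (x, y)"
      by (cases l)
    have fst_s: "fst (s n) \<in> X" "snd (s n) \<in> lower_level_solutions f K (fst (s n))" for n
      using s(1)[rule_format, of n] by (cases "s n"; simp)+
    have "s n \<in> Sigma X K" for n
      using s(1)[rule_format, of n] by (auto simp: lower_level_solutions_iff)
    then have "(x, y) \<in> Sigma X K"
      using closed_sequentially[OF compact_imp_closed[OF K(3)]] s(2) l by metis
    then have xy: "x \<in> X" "y \<in> K x"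
      by auto
    have "f (x, y) \<le> f (x, z)" if z: "z \<in> K x" for z
    proof (rule ccontr)
      assume "\<not> ?thesis"
      \<comment> \<open>A level strictly between the two values leaves room for both to be
        perturbed.\<close>
      then obtain c where c: "f (x, z) < c" "c < f (x, y)"
        using dense by (metis not_le)
      have "open {p. f p < c}"
        using f by (intro open_Collect_less continuous_intros)
      \<comment> \<open>A box separates the roles: convergence puts the parameters in
        \<open>A\<close>, while lower semicontinuity of \<open>K\<close> finds feasible points in
        \<open>B\<close>.\<close>
      then obtain A B where AB: "open A" "open B" "x \<in> A" "z \<in> B" "A \<times> B \<subseteq> {p. f p < c}"
        using c(1) by (metis (mono_tags) open_prod_elim mem_Collect_eq mem_Sigma_iff)
      have "openin (top_of_set Y) (Y \<inter> B)" "K x \<inter> (Y \<inter> B) \<noteq> {}"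
        using AB z xy K(1) by (auto simp: set_valued_map_on_def openin_open_Int)
      then obtain U where U: "openin (top_of_set X) U" "x \<in> U" "\<And>x'. x' \<in> U \<Longrightarrow> K x' \<inter> (Y \<inter> B) \<noteq> {}"
        using K(2) xy(1) unfolding lsc_map_on_def lsc_map_at_def by meson
      obtain T where T: "open T" "U = X \<inter> T"
        using U(1) by (auto simp: openin_open)
      have lim: "(\<lambda>n. fst (s n)) \<longlonglongrightarrow> x"
        using tendsto_fst[OF s(2)] l by simp
      have "(\<lambda>n. f (s n)) \<longlonglongrightarrow> f (x, y)"
        using continuous_on_tendsto_compose[OF f s(2)] l by simp
      then have "eventually (\<lambda>n. c < f (s n)) sequentially"
        using c(2) by (rule order_tendstoD)
      moreover have "eventually (\<lambda>n. fst (s n) \<in> T) sequentially"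
        using topological_tendstoD[OF lim T(1)] U(2) T(2) by simp
      moreover have "eventually (\<lambda>n. fst (s n) \<in> A) sequentially"
        using topological_tendstoD[OF lim AB(1,3)] .
      ultimately have "eventually (\<lambda>n. c < f (s n) \<and> fst (s n) \<in> T \<and> fst (s n) \<in> A) sequentially"
        by eventually_elim simp
      then obtain n where n: "c < f (s n)" "fst (s n) \<in> T" "fst (s n) \<in> A"
        using eventually_happens'[OF sequentially_bot] by blast
      \<comment> \<open>A single late index \<open>n\<close> suffices: the competitor
        \<open>z'\<close> has value below \<open>c\<close>, whereas the minimizer
        \<open>snd (s n)\<close> has value above \<open>c\<close>.\<close>
      then obtain z' where z': "z' \<in> K (fst (s n))" "z' \<in> B"
        using U(3)[of "fst (s n)"] T(2) fst_s(1) by blast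
      then have "f (fst (s n), z') < c"
        using AB(5) n(3) by blast
      moreover have "f (s n) \<le> f (fst (s n), z')"
        using fst_s(2)[of n] z'(1) by (simp add: lower_level_solutions_iff)
      ultimately show False
        using n(1) by simp
    qed
    then show "l \<in> ?G"
      using xy l by (simp add: lower_level_solutions_iff)
  qed
  moreover have "?G = Sigma X K \<inter> ?G"
    by (auto simp: lower_level_solutions_iff)
  ultimately show ?thesis
    using compact_Int_closed[OF K(3)] by metis
qed

lemma lower_level_solutions_nonempty:
  fixes f :: "'a::topological_space \<times> 'b::topological_space \<Rightarrow> real"
  assumes "continuous_on UNIV f" "compact (K x)" "K x \<noteq> {}"
  shows "lower_level_solutions f K x \<noteq> {}"
proof -
  have "continuous_on (K x) (\<lambda>y. f (x, y))"
    by (rule continuous_on_compose2[OF assms(1)]) (auto intro!: continuous_intros)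
  then obtain y where "y \<in> K x" "\<forall>z\<in>K x. f (x, y) \<le> f (x, z)"
    using continuous_attains_inf[OF assms(2,3)] by blast
  then have "y \<in> lower_level_solutions f K x"
    by (simp add: lower_level_solutions_iff)
  then show ?thesis
    by blast
qed

theorem theorem2p3p1:
  fixes X :: "(real ^ 'p) set"
    and Y :: "(real ^ 'q) set"
    and \<theta>l \<theta>f :: "(real ^ 'p) \<times> (real ^ 'q) \<Rightarrow> real"
    and K :: "real ^ 'p \<Rightarrow> (real ^ 'q) set"
  assumes "closed Y"
    and "set_valued_map_on X Y K"
    and "lower_semicontinuous \<theta>l"
    and "continuous_on UNIV \<theta>f"
    and "X \<noteq> {}" and "compact X"
    and "usc_map_on X Y K" and "lsc_map_on X Y K"
    and "\<forall>x\<in>X. K x \<noteq> {} \<and> compact (K x)"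
  shows "\<exists>xs ys. xs \<in> X \<and> ys \<in> lower_level_solutions \<theta>f K xs \<and>
           (\<forall>x\<in>X. \<forall>y\<in>lower_level_solutions \<theta>f K x. \<theta>l (xs, ys) \<le> \<theta>l (x, y))"
proof -
  let ?G = "Sigma X (lower_level_solutions \<theta>f K)"
  have "compact (Sigma X K)"
    using assms(2,6,7,9) by (auto intro: usc_map_on_compact_graph)
  then have "compact ?G"
    using assms(2,4,8) by (auto intro: compact_graph_lower_level_solutions)
  \<comment> \<open>Any point of \<open>X\<close> has a lower-level minimizer, because
    \<open>\<theta>f\<close> is continuous and the values of \<open>K\<close> are nonempty and
    compact.\<close>
  moreover have "?G \<noteq> {}"
    using lower_level_solutions_nonempty[OF assms(4)] assms(5,9) by fast
  ultimately obtain p where "p \<in> ?G" "\<forall>q\<in>?G. \<theta>l p \<le> \<theta>l q"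
    using lower_semicontinuous_attains_inf[OF assms(3)] by blast
  then show ?thesis
    by (cases p) auto
qed

end
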